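(* Let $\mathcal{H}$ be a real Hilbert space. For every $k\in\mathbb{N}$ let $T_k:\mathcal{H}\to\mathcal{H}$ be $\alpha_k$-averaged with $\alpha_k\in(0,1]$, and suppose $C:=\bigcap_{k\in\mathbb{N}}\operatorname{Fix}T_k\neq\varnothing$. Let $\bar x\in\bigcap_{k\in\mathbb{N}}\operatorname{Fix}T_k$, let $\lambda_k\in(0,\tfrac1{\alpha_k})$ for every $k\in\mathbb{N}$, and let $x_0\in\mathcal{H}$. Define $$(\forall k\in\mathbb{N})\quad x_{k+1}=(1-\lambda_k)x_k+\lambda_kT_kx_k .$$ Then the following hold. (i) $(x_k)_{k\in\mathbb{N}}$ is Fejér monotone with respect to $C$. (ii) Suppose that for every $k\in\mathbb{N}$ the operator $\operatorname{Id}-T_k$ is metrically subregular at $\bar x$ for $0=(\operatorname{Id}-T_k)\bar x$, i.e. for every $k\in\mathbb{N}$ there exist $\gamma_k>0$ and $\delta_k>0$ such that $$(\forall x\in B[\bar x;\delta_k])\quad \operatorname{d}\left(x,(\operatorname{Id}-T_k)^{-1}0\right)\le\gamma_k\|x-T_kx\| .$$ Suppose that $\delta:=\inf_{k\in\mathbb{N}}\delta_k>0$ and $x_0\in B[\bar x;\delta]$. Define $\rho_k:=\left(1-\frac{\lambda_k(1-\lambda_k\alpha_k)}{\alpha_k\gamma_k^2}\right)^{1/2}$ for every $k\in\mathbb{N}$. Then: (a) for every $k\in\mathbb{N}$, $x_k\in B[\bar x;\delta]$ and $\operatorname{d}(x_{k+1},\operatorname{Fix}T_k)\le\rho_k\operatorname{d}(x_k,\operatorname{Fix}T_k)$.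 (b) Suppose that $\operatorname{Fix}T_k=C$ for every $k\in\mathbb{N}$ and that $0<\underline\lambda:=\liminf_{k\to\infty}\lambda_k\le\overline\lambda:=\limsup_{k\to\infty}\lambda_k<\frac1\alpha$, where $\alpha:=\limsup_{k\to\infty}\alpha_k>0$, and $\gamma:=\limsup_{k\to\infty}\gamma_k<\infty$. Define $\rho:=\limsup_{k\to\infty}\rho_k$. Then: (b.i) $0\le\rho\le\left(1-\frac{\underline\lambda\left(\frac1\alpha-\overline\lambda\right)}{\gamma^2}\right)^{1/2}<\frac{1}{\left(1+\frac{\underline\lambda\left(\frac1\alpha-\overline\lambda\right)}{\gamma^2}\right)^{1/2}}<1$; (b.ii) there exist $K\in\mathbb{N}$ and $\mu\in(\rho,1)$ such that $\operatorname{d}(x_{k+1},C)\le\mu\operatorname{d}(x_k,C)$ for every $k\ge K$; (b.iii) there exist $\hat x\in C$, $K\in\mathbb{N}$ and $\mu\in(\rho,1)$ such that $$(\forall k\ge K)\quad \|x_k-\hat x\|\le2\mu^{k-K}\operatorname{d}(x_K,C);$$ consequently, $(x_k)_{k\in\mathbb{N}}$ converges $R$-linearly to a point $\hat x\in C$. In particular, if $C$ is affine, then $\hat x=\operatorname{P}_Cx_0$.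
   Context: $\mathbb{N}=\{0,1,2,\ldots\}$. An operator $R:\mathcal{H}\to\mathcal{H}$ is nonexpansive if $\|Rx-Ry\|\le\|x-y\|$ for all $x,y$. For $\alpha\in(0,1]$, $T:\mathcal{H}\to\mathcal{H}$ is $\alpha$-averaged if there is a nonexpansive $R:\mathcal{H}\to\mathcal{H}$ with $T=(1-\alpha)\operatorname{Id}+\alpha R$. $\operatorname{Fix}T=\{x:Tx=x\}$; $(\operatorname{Id}-T)^{-1}0=\{x: x-Tx=0\}=\operatorname{Fix}T$. $B[\bar x;r]=\{y\in\mathcal{H}:\|y-\bar x\|\le r\}$; $\operatorname{d}(x,C)=\inf_{y\in C}\|x-y\|$; $\operatorname{P}_C$ is the projection onto the nonempty closed convex set $C$. A nonempty set $C$ is affine if $\lambda x+(1-\lambda)y\in C$ for all $x,y\in C$ and $\lambda\in\mathbb{R}$. $(x_k)$ is Fejér monotone with respect to $C$ if $\|x_{k+1}-x\|\le\|x_k-x\|$ for all $x\in C$ and $k\in\mathbb{N}$. A sequence $(y_k)$ converging to $\bar y$ converges $R$-linearly to $\bar y$ if $\limsup_{k\to\infty}\|y_k-\bar y\|^{1/k}<1$.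
   Formalization: In (b.i) it is additionally assumed that 1 − λ_k(1−λ_kα_k)/(α_kγ_k²) ≥ 0 for every k, so that ρ_k is a real number; this can fail when T_k is the identity on B[x̄;δ_k] (e.g. T_k = Id with small γ_k). *)

theory Defs
  imports "HOL-Analysis.Analysis"
begin

definition nonexpansive :: "('a::real_normed_vector \<Rightarrow> 'a) \<Rightarrow> bool" where
  "nonexpansive R \<longleftrightarrow> (\<forall>x y. norm (R x - R y) \<le> norm (x - y))"

definition averaged :: "real \<Rightarrow> ('a::real_normed_vector \<Rightarrow> 'a) \<Rightarrow> bool" where
  "averaged \<alpha> T \<longleftrightarrow>
     (\<exists>R. nonexpansive R \<and> (\<forall>x. T x = (1 - \<alpha>) *\<^sub>R x + \<alpha> *\<^sub>R R x))"

definition Fixpts :: "('a \<Rightarrow> 'a) \<Rightarrow> 'a set" where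
  "Fixpts T = {x. T x = x}"

definition fejer_monotone :: "(nat \<Rightarrow> 'a::real_normed_vector) \<Rightarrow> 'a set \<Rightarrow> bool" where
  "fejer_monotone x C \<longleftrightarrow> (\<forall>c\<in>C. \<forall>k. norm (x (Suc k) - c) \<le> norm (x k - c))"

text \<open>Metric subregularity of a single-valued operator at \<open>xbar\<close> for \<open>ybar = F xbar\<close>, with
  the modulus \<open>\<gamma>\<close> and the radius \<open>\<delta>\<close> of the neighbourhood made explicit. The preimage is
  nonempty (it contains \<open>xbar\<close>), so the convention \<open>infdist x {} = 0\<close> never matters.\<close>

definition metrically_subregular_with ::
    "('a::real_normed_vector \<Rightarrow> 'a) \<Rightarrow> 'a \<Rightarrow> 'a \<Rightarrow> real \<Rightarrow> real \<Rightarrow> bool" where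
  "metrically_subregular_with F xbar ybar \<gamma> \<delta> \<longleftrightarrow>
     F xbar = ybar \<and> \<gamma> > 0 \<and> \<delta> > 0 \<and>
     (\<forall>x\<in>cball xbar \<delta>. infdist x (F -` {ybar}) \<le> \<gamma> * norm (F x - ybar))"

text \<open>\<open>closest_point\<close> from the library is restricted to Heine-Borel spaces, i.e. to finite
  dimension. In a Hilbert space the minimizer below exists and is unique for nonempty
  closed convex \<open>C\<close>.\<close>

definition proj :: "'a::real_inner set \<Rightarrow> 'a \<Rightarrow> 'a" where
  "proj C x = (THE p. p \<in> C \<and> (\<forall>y\<in>C. norm (x - p) \<le> norm (x - y)))"

definition converges_R_linearly :: "(nat \<Rightarrow> 'a::real_normed_vector) \<Rightarrow> 'a \<Rightarrow> bool" where
  "converges_R_linearly y ybar \<longleftrightarrow>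
     y \<longlonglongrightarrow> ybar \<and> limsup (\<lambda>k. ereal (root k (norm (y k - ybar)))) < 1"

end

theory Submission
  imports Defs
begin

text \<open>
  If \<open>T = (1 - \<alpha>) Id + \<alpha> R\<close> with \<open>R\<close> nonexpansive, then the relaxed step
  \<open>(1 - \<lambda>) x + \<lambda> T x\<close> is the convex combination of \<open>x\<close> and \<open>R x\<close> with weight
  \<open>\<lambda> \<alpha> < 1\<close>. The Hilbert space identity for convex combinations turns this into a
  quantitative decrease: the squared distance to every fixed point drops by at least
  \<open>\<lambda> (1 - \<lambda> \<alpha>) / \<alpha>\<close> times \<open>\<parallel>x - T x\<parallel>\<^sup>2\<close> (lemma \<open>averaged_relaxed_step\<close>). Fejer
  monotonicity follows at once, and it confines the iterates to the ball where the
  subregularity estimates hold. There the residual \<open>\<parallel>x - T x\<parallel>\<close> dominates the distance to the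
  fixed point set, so that the decrease becomes a contraction of this distance
  (\<open>averaged_relaxed_step_infdist\<close>).

  The hypotheses on the limits keep the contraction factors away from 1. Replacing each
  limit superior by itself plus \<open>e\<close>, and the limit inferior of the relaxation parameters
  by itself minus \<open>e\<close>, gives an upper bound for the factors that is valid from some index on.
  One small \<open>e\<close> suffices for a uniform factor \<open>\<mu> < 1\<close> (\<open>ex_uniform_factor\<close>), while
  \<open>e \<rightarrow> 0\<close> yields the explicit bound on the limit superior (\<open>limsup_factor_le\<close>).

  A Fejer monotone sequence satisfies \<open>\<parallel>x m - x k\<parallel> \<le> 2 d (x k, C)\<close> for all later \<open>m\<close>,
  so geometric decay of the distance to \<open>C\<close> makes it a Cauchy sequence and bounds its distance
  to the limit (\<open>fejer_monotone_linear_limit\<close>). If \<open>C\<close> is affine, then the limit is compared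
  with the starting point along whole lines in \<open>C\<close> through the limit; this forces
  \<open>x 0 - xhat\<close> to be orthogonal to \<open>C - xhat\<close>, which identifies \<open>xhat\<close> as the projection
  of \<open>x 0\<close> (\<open>fejer_monotone_affine_limit\<close>).
\<close>

section \<open>One relaxed step of an averaged operator\<close>

lemma averaged_imp_nonexpansive:
  fixes T :: "'a::real_normed_vector \<Rightarrow> 'a"
  assumes "averaged \<alpha> T" "0 \<le> \<alpha>" "\<alpha> \<le> 1"
  shows "nonexpansive T"
proof -
  obtain R where R: "nonexpansive R" "\<And>x. T x = (1 - \<alpha>) *\<^sub>R x + \<alpha> *\<^sub>R R x"
    using assms(1) unfolding averaged_def by blast
  have "norm (T x - T y) \<le> norm (x - y)" for x y
  proof -
    have "T x - T y = (1 - \<alpha>) *\<^sub>R (x - y) + \<alpha> *\<^sub>R (R x - R y)"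
      by (simp add: R(2) algebra_simps)
    then have "norm (T x - T y) \<le> (1 - \<alpha>) * norm (x - y) + \<alpha> * norm (R x - R y)"
      using norm_triangle_ineq[of "(1 - \<alpha>) *\<^sub>R (x - y)" "\<alpha> *\<^sub>R (R x - R y)"] assms by simp
    also have "\<dots> \<le> (1 - \<alpha>) * norm (x - y) + \<alpha> * norm (x - y)"
      using R(1) assms unfolding nonexpansive_def by (intro add_left_mono mult_left_mono) auto
    finally show ?thesis by (simp add: algebra_simps)
  qed
  then show ?thesis unfolding nonexpansive_def by blast
qed

lemma closed_Fixpts:
  fixes T :: "'a::real_normed_vector \<Rightarrow> 'a"
  assumes "nonexpansive T"
  shows "closed (Fixpts T)"
proof -
  have "continuous_on UNIV T"
    unfolding continuous_on_iff
    using assms unfolding nonexpansive_def dist_norm by (meson order_le_less_trans)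
  then have "closed {x. T x = x}"
    by (intro closed_Collect_eq continuous_on_id) auto
  then show ?thesis by (simp add: Fixpts_def)
qed

lemma norm_convex_combination_power2:
  fixes u v :: "'a::real_inner"
  shows "(norm ((1 - b) *\<^sub>R u + b *\<^sub>R v))\<^sup>2
    = (1 - b) * (norm u)\<^sup>2 + b * (norm v)\<^sup>2 - b * (1 - b) * (norm (u - v))\<^sup>2"
  unfolding power2_norm_eq_inner
  by (simp add: inner_add_left inner_add_right inner_diff_left inner_diff_right
      inner_commute[of v u]) algebra

text \<open>The step equals \<open>(1 - l \<alpha>) x + l \<alpha> R x\<close>, and \<open>R\<close> does not increase the distance to
  its fixed point \<open>z\<close>; the last term of the identity above is the gain, rewritten with
  \<open>x - T x = \<alpha> (x - R x)\<close>.\<close>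

lemma averaged_relaxed_step:
  fixes T :: "'a::real_inner \<Rightarrow> 'a"
  assumes "averaged \<alpha> T" "0 < \<alpha>" "T z = z" "0 \<le> l"
  shows "(norm ((1 - l) *\<^sub>R x + l *\<^sub>R T x - z))\<^sup>2
    \<le> (norm (x - z))\<^sup>2 - l * (1 - l * \<alpha>) / \<alpha> * (norm (x - T x))\<^sup>2"
proof -
  obtain R where R: "nonexpansive R" "\<And>x. T x = (1 - \<alpha>) *\<^sub>R x + \<alpha> *\<^sub>R R x"
    using assms(1) unfolding averaged_def by blast
  have "\<alpha> *\<^sub>R R z = \<alpha> *\<^sub>R z"
    using R(2)[of z] assms(3) by (auto simp: algebra_simps)
  then have "R z = z" using assms(2) by simp
  then have Rxz: "norm (R x - z) \<le> norm (x - z)"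
    using R(1) unfolding nonexpansive_def by metis
  have "(1 - l) *\<^sub>R x + l *\<^sub>R T x - z = (1 - l * \<alpha>) *\<^sub>R (x - z) + (l * \<alpha>) *\<^sub>R (R x - z)"
    by (simp add: R(2) algebra_simps)
  then have "(norm ((1 - l) *\<^sub>R x + l *\<^sub>R T x - z))\<^sup>2
      = (1 - l * \<alpha>) * (norm (x - z))\<^sup>2 + l * \<alpha> * (norm (R x - z))\<^sup>2
        - l * \<alpha> * (1 - l * \<alpha>) * (norm (x - R x))\<^sup>2"
    by (simp add: norm_convex_combination_power2)
  also have "\<dots> \<le> (1 - l * \<alpha>) * (norm (x - z))\<^sup>2 + l * \<alpha> * (norm (x - z))\<^sup>2
        - l * \<alpha> * (1 - l * \<alpha>) * (norm (x - R x))\<^sup>2"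
    using Rxz assms by (intro diff_right_mono add_left_mono mult_left_mono power_mono) auto
  also have "\<dots> = (norm (x - z))\<^sup>2 - l * \<alpha> * (1 - l * \<alpha>) * (norm (x - R x))\<^sup>2"
    by (simp add: algebra_simps)
  also have "l * \<alpha> * (1 - l * \<alpha>) * (norm (x - R x))\<^sup>2
      = l * (1 - l * \<alpha>) / \<alpha> * (norm (x - T x))\<^sup>2"
  proof -
    have "x - T x = \<alpha> *\<^sub>R (x - R x)" by (simp add: R(2) algebra_simps)
    then have "(norm (x - T x))\<^sup>2 = \<alpha>\<^sup>2 * (norm (x - R x))\<^sup>2"
      by (simp add: power_mult_distrib)
    then show ?thesis using assms(2) by (simp add: power2_eq_square)
  qed
  finally show ?thesis .
qed

text \<open>Lets a decrease by an amount independent of \<open>z\<close> pass to the infimum over \<open>z \<in> F\<close>,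
  which need not be attained.\<close>

lemma infdist_power2_le_infdist_power2_diff:
  fixes x y :: "'a::real_normed_vector"
  assumes "F \<noteq> {}" and decrease: "\<And>z. z \<in> F \<Longrightarrow> (norm (y - z))\<^sup>2 \<le> (norm (x - z))\<^sup>2 - b"
  shows "(infdist y F)\<^sup>2 \<le> (infdist x F)\<^sup>2 - b"
proof -
  have bound: "sqrt ((infdist y F)\<^sup>2 + b) \<le> dist x z" if "z \<in> F" for z
  proof -
    have "(infdist y F)\<^sup>2 \<le> (norm (y - z))\<^sup>2"
      using infdist_le[OF that, of y] by (intro power_mono infdist_nonneg) (simp add: dist_norm)
    then have "(infdist y F)\<^sup>2 + b \<le> (norm (x - z))\<^sup>2" using decrease[OF that] by simp
    then show ?thesis by (simp add: dist_norm real_le_lsqrt real_sqrt_le_iff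
        order_trans[OF real_sqrt_le_mono])
  qed
  have "sqrt ((infdist y F)\<^sup>2 + b) \<le> infdist x F"
    unfolding infdist_notempty[OF assms(1), of x]
    by (intro cINF_greatest assms(1)) (rule bound)
  then have "(infdist y F)\<^sup>2 + b \<le> (infdist x F)\<^sup>2"
    by (rule sqrt_le_D)
  then show ?thesis by simp
qed

text \<open>The gain of the relaxed step is at least \<open>l (1 - l \<alpha>) / (\<alpha> \<gamma>\<^sup>2)\<close> times the
  squared distance to the fixed point set, because the error bound estimates the residual from
  below. The radicand may be negative, in which case the squared distance, and with it both sides
  of the inequality, must vanish. The proof treats both signs at once: \<open>sqrt\<close> is extended to
  negative numbers as an odd function, and as such it is still monotone and multiplicative.\<close>

lemma averaged_relaxed_step_infdist:
  fixes T :: "'a::real_inner \<Rightarrow> 'a"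
  assumes "averaged \<alpha> T" "0 < \<alpha>" "0 \<le> l" "l \<le> 1 / \<alpha>" "0 < \<gamma>" "Fixpts T \<noteq> {}"
    and error_bound: "infdist x (Fixpts T) \<le> \<gamma> * norm (x - T x)"
  shows "infdist ((1 - l) *\<^sub>R x + l *\<^sub>R T x) (Fixpts T)
    \<le> sqrt (1 - l * (1 - l * \<alpha>) / (\<alpha> * \<gamma>\<^sup>2)) * infdist x (Fixpts T)"
proof -
  define y where "y = (1 - l) *\<^sub>R x + l *\<^sub>R T x"
  define d where "d = infdist x (Fixpts T)"
  define c where "c = l * (1 - l * \<alpha>) / \<alpha>"
  have d0: "0 \<le> d" by (simp add: d_def infdist_nonneg)
  have "l * \<alpha> \<le> 1" using assms(2,4) by (simp add: field_simps)
  then have c0: "0 \<le> c" using assms(2,3) by (simp add: c_def)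
  have "d / \<gamma> \<le> norm (x - T x)"
    using error_bound \<open>0 < \<gamma>\<close> by (simp add: d_def field_simps)
  then have "(d / \<gamma>)\<^sup>2 \<le> (norm (x - T x))\<^sup>2"
    using d0 \<open>0 < \<gamma>\<close> by (intro power_mono) auto
  then have gap: "c * (d / \<gamma>)\<^sup>2 \<le> c * (norm (x - T x))\<^sup>2" using c0 by (rule mult_left_mono)
  have "(norm (y - z))\<^sup>2 \<le> (norm (x - z))\<^sup>2 - c * (d / \<gamma>)\<^sup>2" if "z \<in> Fixpts T" for z
    using averaged_relaxed_step[OF assms(1,2) _ assms(3), of z x] that gap
    unfolding Fixpts_def y_def c_def by force
  then have "(infdist y (Fixpts T))\<^sup>2 \<le> d\<^sup>2 - c * (d / \<gamma>)\<^sup>2"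
    unfolding d_def by (rule infdist_power2_le_infdist_power2_diff[OF assms(6)])
  also have "\<dots> = (1 - c / \<gamma>\<^sup>2) * d\<^sup>2"
    by (simp add: power_divide algebra_simps)
  finally have "sqrt ((infdist y (Fixpts T))\<^sup>2) \<le> sqrt ((1 - c / \<gamma>\<^sup>2) * d\<^sup>2)"
    by (rule real_sqrt_le_mono)
  then have "infdist y (Fixpts T) \<le> sqrt (1 - c / \<gamma>\<^sup>2) * d"
    using d0 by (simp add: real_sqrt_mult infdist_nonneg)
  then show ?thesis by (simp add: y_def d_def c_def)
qed

section \<open>Fejer monotone sequences\<close>

lemma fejer_monotone_norm_antimono:
  assumes "fejer_monotone x C" "c \<in> C" "k \<le> m"
  shows "norm (x m - c) \<le> norm (x k - c)"
  using assms(3)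
  by (induction m rule: dec_induct)
    (use assms(1,2) in \<open>auto simp: fejer_monotone_def intro: order_trans\<close>)

text \<open>Both \<open>x m\<close> and \<open>x k\<close> lie within \<open>\<parallel>x k - c\<parallel>\<close> of every \<open>c \<in> C\<close>; the factor 2 is
  the diameter of that ball against its radius.\<close>

lemma fejer_monotone_dist_le_infdist:
  fixes x :: "nat \<Rightarrow> 'a::real_normed_vector"
  assumes "fejer_monotone x C" "C \<noteq> {}" "k \<le> m"
  shows "norm (x m - x k) \<le> 2 * infdist (x k) C"
proof -
  have "norm (x m - x k) / 2 \<le> dist (x k) c" if "c \<in> C" for c
    using fejer_monotone_norm_antimono[OF assms(1) that assms(3)]
      norm_triangle_ineq4[of "x m - c" "x k - c"] by (simp add: dist_norm)
  then have "norm (x m - x k) / 2 \<le> infdist (x k) C"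
    unfolding infdist_notempty[OF assms(2)] by (intro cINF_greatest assms(2))
  then show ?thesis by simp
qed

lemma infdist_geometric_decay:
  fixes x :: "nat \<Rightarrow> 'a::metric_space"
  assumes "0 \<le> \<mu>" "\<And>k. K \<le> k \<Longrightarrow> infdist (x (Suc k)) C \<le> \<mu> * infdist (x k) C" "K \<le> k"
  shows "infdist (x k) C \<le> \<mu> ^ (k - K) * infdist (x K) C"
  using assms(3)
proof (induction k rule: dec_induct)
  case base
  then show ?case by simp
next
  case (step k)
  have "infdist (x (Suc k)) C \<le> \<mu> * infdist (x k) C" using assms(2) step by simp
  also have "\<dots> \<le> \<mu> * (\<mu> ^ (k - K) * infdist (x K) C)"
    using step assms(1) by (intro mult_left_mono) auto
  finally show ?case using step by (simp add: Suc_diff_le mult.assoc)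
qed

text \<open>By the previous lemmas the sequence eventually stays near any of its members that is close
  to \<open>C\<close>, so it is a Cauchy sequence; the error bound arises by letting \<open>m\<close> tend to infinity in
  \<open>\<parallel>x m - x k\<parallel> \<le> 2 d (x k, C)\<close>.\<close>

lemma fejer_monotone_linear_limit:
  fixes x :: "nat \<Rightarrow> 'a::{real_normed_vector, complete_space}"
  assumes fejer: "fejer_monotone x C" and "C \<noteq> {}" "closed C" and "0 \<le> \<mu>" "\<mu> < 1"
    and contraction: "\<And>k. K \<le> k \<Longrightarrow> infdist (x (Suc k)) C \<le> \<mu> * infdist (x k) C"
  obtains xhat where "xhat \<in> C" "x \<longlonglongrightarrow> xhat"
    "\<And>k. K \<le> k \<Longrightarrow> norm (x k - xhat) \<le> 2 * \<mu> ^ (k - K) * infdist (x K) C"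
proof -
  have decay: "infdist (x k) C \<le> \<mu> ^ (k - K) * infdist (x K) C" if "K \<le> k" for k
    by (rule infdist_geometric_decay[where C = C and x = x, OF \<open>0 \<le> \<mu>\<close> _ that]) (rule contraction)
  have pow: "(\<lambda>k. \<mu> ^ (k - K)) \<longlonglongrightarrow> 0"
    by (rule LIMSEQ_offset[where k = K]) (use assms(4,5) in \<open>simp add: LIMSEQ_power_zero\<close>)
  have infdist0: "(\<lambda>k. infdist (x k) C) \<longlonglongrightarrow> 0"
  proof (rule tendsto_sandwich[OF _ _ tendsto_const])
    show "(\<lambda>k. \<mu> ^ (k - K) * infdist (x K) C) \<longlonglongrightarrow> 0"
      using tendsto_mult_right[OF pow, of "infdist (x K) C"] by simp
  qed (use decay in \<open>auto simp: infdist_nonneg eventually_sequentially\<close>)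
  have "Cauchy x"
  proof (rule metric_CauchyI)
    fix e :: real assume "0 < e"
    then have "\<forall>\<^sub>F k in sequentially. infdist (x k) C < e / 4"
      by (intro order_tendstoD(2)[OF infdist0]) simp
    then obtain M where M: "infdist (x M) C < e / 4"
      by (auto simp: eventually_sequentially)
    have near: "norm (x m - x M) < e / 2" if "M \<le> m" for m
      using fejer_monotone_dist_le_infdist[OF fejer assms(2) that] M by simp
    have "dist (x m) (x n) < e" if "M \<le> m" "M \<le> n" for m n
      using near[OF that(1)] near[OF that(2)] norm_triangle_ineq4[of "x m - x M" "x n - x M"]
      by (simp add: dist_norm)
    then show "\<exists>M. \<forall>m\<ge>M. \<forall>n\<ge>M. dist (x m) (x n) < e" by blast
  qed
  then obtain xhat where lim: "x \<longlonglongrightarrow> xhat"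
    using Cauchy_convergent unfolding convergent_def by blast
  have "infdist xhat C = 0"
    using tendsto_infdist[OF lim, of C] infdist0 LIMSEQ_unique by blast
  then have "xhat \<in> C"
    using in_closed_iff_infdist_zero[OF \<open>closed C\<close> \<open>C \<noteq> {}\<close>] by simp
  moreover have "norm (x k - xhat) \<le> 2 * \<mu> ^ (k - K) * infdist (x K) C" if "K \<le> k" for k
  proof -
    have "(\<lambda>m. norm (x m - x k)) \<longlonglongrightarrow> norm (xhat - x k)"
      by (intro tendsto_intros lim)
    then have "norm (xhat - x k) \<le> 2 * infdist (x k) C"
      by (rule LIMSEQ_le_const2)
        (use fejer_monotone_dist_le_infdist[OF fejer \<open>C \<noteq> {}\<close>] in blast)
    then show ?thesis using decay[OF that] by (simp add: norm_minus_commute)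
  qed
  ultimately show thesis using that lim by blast
qed

text \<open>The constant and the shift by \<open>K\<close> disappear in the limit because the \<open>k\<close>-th root of a
  fixed positive number tends to 1.\<close>

lemma converges_R_linearly_if_geometric_bound:
  fixes y :: "nat \<Rightarrow> 'a::real_normed_vector"
  assumes "0 < \<mu>" "\<mu> < 1" "0 \<le> D"
    and bound: "\<And>k. K \<le> k \<Longrightarrow> norm (y k - ybar) \<le> D * \<mu> ^ (k - K)"
  shows "converges_R_linearly y ybar"
proof -
  \<comment> \<open>The summand 1 keeps the constant positive even if \<open>D = 0\<close>, so that its roots tend to 1.\<close>
  define A where "A = D / \<mu> ^ K + 1"
  have A: "0 < A" using assms by (simp add: A_def add_nonneg_pos)
  have le: "norm (y k - ybar) \<le> A * \<mu> ^ k" if "K \<le> k" for k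
  proof -
    have "norm (y k - ybar) \<le> D / \<mu> ^ K * \<mu> ^ k"
      using bound[OF that] \<open>0 < \<mu>\<close> that by (simp add: power_diff)
    also have "\<dots> \<le> A * \<mu> ^ k"
      using \<open>0 < \<mu>\<close> unfolding A_def by (intro mult_right_mono) auto
    finally show ?thesis .
  qed
  have "(\<lambda>k. y k - ybar) \<longlonglongrightarrow> 0"
  proof (rule Lim_null_comparison)
    show "\<forall>\<^sub>F k in sequentially. norm (y k - ybar) \<le> A * \<mu> ^ k"
      using le by (auto simp: eventually_sequentially)
    show "(\<lambda>k. A * \<mu> ^ k) \<longlonglongrightarrow> 0"
      using tendsto_mult_left[OF LIMSEQ_power_zero, of \<mu> A] assms by simp
  qed
  then have lim: "y \<longlonglongrightarrow> ybar" by (simp add: LIM_zero_iff)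
  have "root k (norm (y k - ybar)) \<le> root k A * \<mu>" if "max 1 K \<le> k" for k
  proof -
    have "root k (norm (y k - ybar)) \<le> root k (A * \<mu> ^ k)"
      using le that by (intro real_root_le_mono) auto
    also have "\<dots> = root k A * \<mu>"
      using that \<open>0 < \<mu>\<close> by (simp add: real_root_mult real_root_power_cancel)
    finally show ?thesis .
  qed
  then have "\<forall>\<^sub>F k in sequentially. ereal (root k (norm (y k - ybar))) \<le> ereal (root k A * \<mu>)"
    by (auto simp: eventually_sequentially intro!: exI[of _ "max 1 K"])
  then have "limsup (\<lambda>k. ereal (root k (norm (y k - ybar)))) \<le> limsup (\<lambda>k. ereal (root k A * \<mu>))"
    by (rule Limsup_mono)
  also have "(\<lambda>k. ereal (root k A * \<mu>)) \<longlonglongrightarrow> ereal (1 * \<mu>)"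
    by (intro tendsto_intros LIMSEQ_root_const A)
  then have "limsup (\<lambda>k. ereal (root k A * \<mu>)) = ereal \<mu>"
    by (intro lim_imp_Limsup) auto
  also have "ereal \<mu> < 1" using assms(2) by simp
  finally show ?thesis using lim by (simp add: converges_R_linearly_def)
qed

lemma proj_eqI_orthogonal:
  assumes "p \<in> C" and orthogonal: "\<And>c. c \<in> C \<Longrightarrow> inner (x - p) (c - p) = 0"
  shows "proj C x = p"
proof -
  have pythagoras: "(norm (x - c))\<^sup>2 = (norm (x - p))\<^sup>2 + (norm (c - p))\<^sup>2" if "c \<in> C" for c
    using orthogonal[OF that] unfolding power2_norm_eq_inner
    by (simp add: inner_diff_left inner_diff_right inner_commute)
  show ?thesis
    unfolding proj_def
  proof (rule the_equality)
    show "p \<in> C \<and> (\<forall>y\<in>C. norm (x - p) \<le> norm (x - y))"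
      using assms(1) pythagoras by (metis le_add_same_cancel1 norm_ge_zero power2_le_imp_le zero_le_power2)
  next
    fix q assume q: "q \<in> C \<and> (\<forall>y\<in>C. norm (x - q) \<le> norm (x - y))"
    then have "(norm (x - q))\<^sup>2 \<le> (norm (x - p))\<^sup>2"
      using assms(1) by (intro power_mono) auto
    then show "q = p" using pythagoras[of q] q by simp
  qed
qed

text \<open>The limit is at least as close as \<open>x 0\<close> to every point of the line through \<open>xhat\<close> and
  \<open>c\<close>. On that line the quadratic terms of the two squared distances cancel, so an affine function
  of the parameter is bounded; hence its slope, the inner product of \<open>x 0 - xhat\<close> and
  \<open>c - xhat\<close>, is zero.\<close>

lemma fejer_monotone_affine_limit:
  fixes x :: "nat \<Rightarrow> 'a::real_inner"
  assumes fejer: "fejer_monotone x C" and "affine C" and lim: "x \<longlonglongrightarrow> xhat" and "xhat \<in> C"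
  shows "xhat = proj C (x 0)"
proof -
  have closer: "norm (xhat - c) \<le> norm (x 0 - c)" if "c \<in> C" for c
  proof (rule LIMSEQ_le_const2)
    show "(\<lambda>k. norm (x k - c)) \<longlonglongrightarrow> norm (xhat - c)" by (intro tendsto_intros lim)
    show "\<exists>N. \<forall>n\<ge>N. norm (x n - c) \<le> norm (x 0 - c)"
      using fejer_monotone_norm_antimono[OF fejer that] by blast
  qed
  have "inner (x 0 - xhat) (c - xhat) = 0" if "c \<in> C" for c
  proof -
    define u where "u = x 0 - xhat"
    define v where "v = c - xhat"
    have bounded: "2 * t * inner u v \<le> (norm u)\<^sup>2" for t
    proof -
      have "(1 - t) *\<^sub>R xhat + t *\<^sub>R c \<in> C"
        using \<open>affine C\<close> \<open>xhat \<in> C\<close> that by (simp add: affine_alt)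
      moreover have "xhat - ((1 - t) *\<^sub>R xhat + t *\<^sub>R c) = - (t *\<^sub>R v)"
        "x 0 - ((1 - t) *\<^sub>R xhat + t *\<^sub>R c) = u - t *\<^sub>R v"
        by (simp_all add: u_def v_def algebra_simps)
      ultimately have "(norm (t *\<^sub>R v))\<^sup>2 \<le> (norm (u - t *\<^sub>R v))\<^sup>2"
        using closer by (metis norm_ge_zero norm_minus_cancel power_mono)
      then show ?thesis
        unfolding power2_norm_eq_inner
        by (simp add: inner_diff_left inner_diff_right inner_commute)
    qed
    have "inner u v = 0"
    proof (rule ccontr)
      assume nz: "inner u v \<noteq> 0"
      \<comment> \<open>A parameter for which the linear term exceeds its bound by 1.\<close>
      have "2 * (((norm u)\<^sup>2 + 1) / (2 * inner u v)) * inner u v = (norm u)\<^sup>2 + 1"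
        using nz by (simp add: field_simps)
      then show False using bounded[of "((norm u)\<^sup>2 + 1) / (2 * inner u v)"] by simp
    qed
    then show ?thesis by (simp add: u_def v_def)
  qed
  then show ?thesis using proj_eqI_orthogonal[OF \<open>xhat \<in> C\<close>] by metis
qed

section \<open>The asymptotic contraction factor\<close>

text \<open>The data shared by the asymptotic estimates. The limits are real numbers, and \<open>g = 0\<close> is
  possible: the moduli are positive, but they may tend to zero.\<close>

locale step_limits =
  fixes \<alpha> lam \<gamma> :: "nat \<Rightarrow> real" and a lmin lmax g :: real
  assumes alpha_pos: "\<And>k. 0 < \<alpha> k" and gamma_pos: "\<And>k. 0 < \<gamma> k"
    and liminf_lam: "liminf (\<lambda>k. ereal (lam k)) = ereal lmin"
    and limsup_lam: "limsup (\<lambda>k. ereal (lam k)) = ereal lmax"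
    and limsup_alpha: "limsup (\<lambda>k. ereal (\<alpha> k)) = ereal a"
    and limsup_gamma: "limsup (\<lambda>k. ereal (\<gamma> k)) = ereal g"
    and a_pos: "0 < a" and lmin_pos: "0 < lmin" and lmax_less: "lmax < 1 / a"
begin

text \<open>For small \<open>e > 0\<close> this is an eventual lower bound for \<open>lam k (1 / \<alpha> k - lam k)\<close>, the
  numerator of the decrease; \<open>gain 0\<close> is the constant that governs the limit.\<close>

definition gain :: "real \<Rightarrow> real" where
  "gain e = (lmin - e) * (1 / (a + e) - (lmax + e))"

definition factor :: "nat \<Rightarrow> real" where
  "factor k = sqrt (1 - lam k * (1 - lam k * \<alpha> k) / (\<alpha> k * (\<gamma> k)\<^sup>2))"

lemma g_nonneg: "0 \<le> g"
proof -
  have "0 \<le> limsup (\<lambda>k. ereal (\<gamma> k))"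
    by (rule le_Limsup) (use gamma_pos in \<open>auto intro: always_eventually less_imp_le\<close>)
  then show ?thesis by (simp add: limsup_gamma)
qed

lemma gain_0: "0 < gain 0" "gain 0 = lmin * (1 / a - lmax)"
  using lmin_pos lmax_less by (simp_all add: gain_def)

lemma gain_tendsto: "(gain \<longlongrightarrow> gain 0) (at_right 0)"
  unfolding gain_def by (intro tendsto_intros) (use a_pos in auto)

lemma eventually_gain_pos:
  "\<forall>\<^sub>F e in at_right 0. 0 < e \<and> 0 < lmin - e \<and> 0 < 1 / (a + e) - (lmax + e)"
proof -
  have "((\<lambda>e. lmin - e) \<longlongrightarrow> lmin - 0) (at_right 0)"
    "((\<lambda>e. 1 / (a + e) - (lmax + e)) \<longlongrightarrow> 1 / (a + 0) - (lmax + 0)) (at_right 0)"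
    by (intro tendsto_intros; use a_pos in simp)+
  from this[THEN order_tendstoD(1), of 0]
  have "\<forall>\<^sub>F e in at_right 0. 0 < lmin - e"
    "\<forall>\<^sub>F e in at_right 0. 0 < 1 / (a + e) - (lmax + e)"
    using lmin_pos lmax_less by simp_all
  then show ?thesis using eventually_at_right_less[of "0::real"] by eventually_elim auto
qed

text \<open>All four limits are relaxed by the same \<open>e\<close>, each in its unfavourable direction, which
  makes the corresponding strict inequalities hold from some index on. Relaxing \<open>g\<close> also keeps the
  denominator on the left positive when \<open>g = 0\<close>.\<close>

lemma eventually_gain_le:
  assumes "0 < e" "0 < lmin - e" "0 < 1 / (a + e) - (lmax + e)"
  shows "\<forall>\<^sub>F k in sequentially. gain e / (g + e)\<^sup>2
    \<le> lam k * (1 - lam k * \<alpha> k) / (\<alpha> k * (\<gamma> k)\<^sup>2)"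
proof -
  have "\<forall>\<^sub>F k in sequentially. ereal (lmin - e) < ereal (lam k)"
    using less_LiminfD[of "ereal (lmin - e)" sequentially "\<lambda>k. ereal (lam k)"] assms(1)
    by (simp add: liminf_lam)
  moreover have "\<forall>\<^sub>F k in sequentially. ereal (lam k) < ereal (lmax + e)"
    using Limsup_lessD[of sequentially "\<lambda>k. ereal (lam k)" "ereal (lmax + e)"] assms(1)
    by (simp add: limsup_lam)
  moreover have "\<forall>\<^sub>F k in sequentially. ereal (\<alpha> k) < ereal (a + e)"
    using Limsup_lessD[of sequentially "\<lambda>k. ereal (\<alpha> k)" "ereal (a + e)"] assms(1)
    by (simp add: limsup_alpha)
  moreover have "\<forall>\<^sub>F k in sequentially. ereal (\<gamma> k) < ereal (g + e)"
    using Limsup_lessD[of sequentially "\<lambda>k. ereal (\<gamma> k)" "ereal (g + e)"] assms(1)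
    by (simp add: limsup_gamma)
  ultimately show ?thesis
  proof eventually_elim
    case (elim k)
    have pos: "0 < \<alpha> k" "0 < \<gamma> k" by (rule alpha_pos gamma_pos)+
    have "1 / (a + e) \<le> 1 / \<alpha> k"
      using elim pos by (intro divide_left_mono mult_pos_pos) auto
    then have "gain e \<le> lam k * (1 / \<alpha> k - lam k)"
      unfolding gain_def using elim assms by (intro mult_mono) auto
    moreover have "(\<gamma> k)\<^sup>2 \<le> (g + e)\<^sup>2" using elim pos by (intro power_mono) auto
    moreover have "0 \<le> gain e" using assms by (simp add: gain_def)
    ultimately have "gain e / (g + e)\<^sup>2 \<le> lam k * (1 / \<alpha> k - lam k) / (\<gamma> k)\<^sup>2"
      using pos by (intro frac_le) auto
    also have "\<dots> = lam k * (1 - lam k * \<alpha> k) / (\<alpha> k * (\<gamma> k)\<^sup>2)"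
      using pos by (simp add: field_simps)
    finally show ?case .
  qed
qed

lemma eventually_factor_le:
  assumes "0 < e" "0 < lmin - e" "0 < 1 / (a + e) - (lmax + e)"
  shows "\<forall>\<^sub>F k in sequentially. factor k \<le> sqrt (1 - gain e / (g + e)\<^sup>2)"
  using eventually_gain_le[OF assms] by eventually_elim (simp add: factor_def)

text \<open>The factors may be eventually negative, with limit superior \<open>-\<infinity>\<close> if \<open>\<gamma>\<close> tends to
  zero. Truncating the eventual bound at 0 makes it a nonnegative number \<open>s < 1\<close>, and the midpoint
  of \<open>s\<close> and 1 is positive and strictly above the limit superior.\<close>

lemma ex_uniform_factor:
  obtains K \<mu> where "limsup (\<lambda>k. ereal (factor k)) < ereal \<mu>" "0 < \<mu>" "\<mu> < 1"
    "\<And>k. K \<le> k \<Longrightarrow> factor k \<le> \<mu>"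
proof -
  obtain e where e: "0 < e" "0 < lmin - e" "0 < 1 / (a + e) - (lmax + e)"
    using eventually_happens'[OF _ eventually_gain_pos] by auto
  have "0 < gain e" using e by (simp add: gain_def)
  then have "0 < gain e / (g + e)\<^sup>2" using e g_nonneg by (intro divide_pos_pos) auto
  define s where "s = max 0 (sqrt (1 - gain e / (g + e)\<^sup>2))"
  have s: "0 \<le> s" "s < 1"
    using \<open>0 < gain e / (g + e)\<^sup>2\<close> by (auto simp: s_def)
  have le: "\<forall>\<^sub>F k in sequentially. factor k \<le> s"
    using eventually_factor_le[OF e] by eventually_elim (simp add: s_def)
  then obtain K where K: "\<And>k. K \<le> k \<Longrightarrow> factor k \<le> s" by (auto simp: eventually_sequentially)
  have "limsup (\<lambda>k. ereal (factor k)) \<le> ereal s"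
    using le by (intro Limsup_bounded) simp
  also have "\<dots> < ereal ((s + 1) / 2)" using s by simp
  finally have "limsup (\<lambda>k. ereal (factor k)) < ereal ((s + 1) / 2)" .
  moreover have "factor k \<le> (s + 1) / 2" if "K \<le> k" for k
  proof -
    have "s \<le> (s + 1) / 2" using s by (simp add: field_simps)
    with K[OF that] show ?thesis by (rule order_trans)
  qed
  ultimately show thesis using s by (intro that[of "(s + 1) / 2" K]) auto
qed

text \<open>If \<open>g = 0\<close>, then nonnegative radicands give \<open>gain e \<le> e\<^sup>2\<close> for all small \<open>e\<close>; in the
  limit this contradicts \<open>gain 0 > 0\<close>. The conclusion excludes a division by zero in the bound
  for the limit superior of the factors.\<close>

lemma g_pos_if_radicands_nonneg:
  assumes "\<And>k. 0 \<le> 1 - lam k * (1 - lam k * \<alpha> k) / (\<alpha> k * (\<gamma> k)\<^sup>2)"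
  shows "0 < g"
proof (rule ccontr)
  assume "\<not> 0 < g"
  then have "g = 0" using g_nonneg by simp
  have "gain e \<le> e\<^sup>2" if "0 < e \<and> 0 < lmin - e \<and> 0 < 1 / (a + e) - (lmax + e)" for e
  proof -
    note small = that
    obtain k where "gain e / e\<^sup>2 \<le> lam k * (1 - lam k * \<alpha> k) / (\<alpha> k * (\<gamma> k)\<^sup>2)"
      using eventually_happens'[OF sequentially_bot eventually_gain_le, of e] small
      unfolding \<open>g = 0\<close> add_0 by blast
    also have "\<dots> \<le> 1" using assms[of k] by simp
    finally show ?thesis using small by (simp add: field_simps)
  qed
  then have "\<forall>\<^sub>F e in at_right 0. gain e \<le> e\<^sup>2"
    by (rule eventually_mono[OF eventually_gain_pos])
  moreover have "((\<lambda>e::real. e\<^sup>2) \<longlongrightarrow> 0\<^sup>2) (at_right 0)" by (intro tendsto_intros)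
  ultimately have "gain 0 \<le> 0\<^sup>2"
    by (intro tendsto_le[OF _ _ gain_tendsto]) auto
  then show False using gain_0 by simp
qed

text \<open>The left-hand side does not depend on \<open>e\<close>, so letting \<open>e\<close> tend to 0 in the eventual
  bound gives the estimate.\<close>

lemma limsup_factor_le:
  assumes "0 < g"
  shows "limsup (\<lambda>k. ereal (factor k)) \<le> ereal (sqrt (1 - gain 0 / g\<^sup>2))"
proof (rule tendsto_lowerbound)
  have "((\<lambda>e. sqrt (1 - gain e / (g + e)\<^sup>2)) \<longlongrightarrow> sqrt (1 - gain 0 / (g + 0)\<^sup>2)) (at_right 0)"
    by (intro tendsto_intros gain_tendsto) (use assms in auto)
  then show "((\<lambda>e. ereal (sqrt (1 - gain e / (g + e)\<^sup>2)))
      \<longlongrightarrow> ereal (sqrt (1 - gain 0 / g\<^sup>2))) (at_right 0)"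
    by (simp add: tendsto_ereal)
  show "\<forall>\<^sub>F e in at_right 0.
      limsup (\<lambda>k. ereal (factor k)) \<le> ereal (sqrt (1 - gain e / (g + e)\<^sup>2))"
    using eventually_gain_pos
  proof eventually_elim
    case (elim e)
    then show ?case using eventually_factor_le[of e] by (intro Limsup_bounded) simp
  qed
qed simp

end

lemma sqrt_one_minus_less_inverse_sqrt_one_plus:
  fixes t :: real
  assumes "0 < t"
  shows "sqrt (1 - t) < 1 / sqrt (1 + t)" "1 / sqrt (1 + t) < 1"
proof -
  have "(1 - t) * (1 + t) < 1" using assms by (simp add: algebra_simps)
  then have "sqrt (1 - t) * sqrt (1 + t) < 1"
    by (metis real_sqrt_lt_1_iff real_sqrt_mult)
  then show "sqrt (1 - t) < 1 / sqrt (1 + t)" using assms by (simp add: field_simps)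
  show "1 / sqrt (1 + t) < 1" using assms by simp
qed

section \<open>The relaxed averaged iteration\<close>

theorem theorem4p9:
  fixes T :: "nat \<Rightarrow> 'a::{real_inner, complete_space} \<Rightarrow> 'a"
    and \<alpha> lam :: "nat \<Rightarrow> real"
    and x :: "nat \<Rightarrow> 'a"
    and xbar :: 'a
    and C :: "'a set"
  assumes alpha: "\<And>k. 0 < \<alpha> k \<and> \<alpha> k \<le> 1"
    and averaged: "\<And>k. averaged (\<alpha> k) (T k)"
    and C: "C = (\<Inter>k. Fixpts (T k))"
    and xbar: "xbar \<in> C"
    and lambda: "\<And>k. 0 < lam k \<and> lam k < 1 / \<alpha> k"
    and iter: "\<And>k. x (Suc k) = (1 - lam k) *\<^sub>R x k + lam k *\<^sub>R T k (x k)"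
  shows
    "fejer_monotone x C \<and>
     (\<forall>\<gamma> \<delta> \<rho> :: nat \<Rightarrow> real.
        (\<forall>k. metrically_subregular_with (\<lambda>z. z - T k z) xbar 0 (\<gamma> k) (\<delta> k)) \<longrightarrow>
        0 < (INF k. \<delta> k) \<longrightarrow>
        x 0 \<in> cball xbar (INF k. \<delta> k) \<longrightarrow>
        (\<forall>k. \<rho> k = sqrt (1 - lam k * (1 - lam k * \<alpha> k) / (\<alpha> k * (\<gamma> k)\<^sup>2))) \<longrightarrow>
        (\<forall>k. x k \<in> cball xbar (INF k. \<delta> k) \<and>
             infdist (x (Suc k)) (Fixpts (T k)) \<le> \<rho> k * infdist (x k) (Fixpts (T k))) \<and>
        (\<forall>(lmin::real) (lmax::real) (a::real) (g::real) (r::ereal).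
           (\<forall>k. Fixpts (T k) = C) \<longrightarrow>
           liminf (\<lambda>k. ereal (lam k)) = ereal lmin \<longrightarrow>
           limsup (\<lambda>k. ereal (lam k)) = ereal lmax \<longrightarrow>
           limsup (\<lambda>k. ereal (\<alpha> k)) = ereal a \<longrightarrow>
           limsup (\<lambda>k. ereal (\<gamma> k)) = ereal g \<longrightarrow>
           0 < a \<longrightarrow> 0 < lmin \<longrightarrow> lmin \<le> lmax \<longrightarrow> lmax < 1 / a \<longrightarrow>
           r = limsup (\<lambda>k. ereal (\<rho> k)) \<longrightarrow>
           ((\<forall>k. 0 \<le> 1 - lam k * (1 - lam k * \<alpha> k) / (\<alpha> k * (\<gamma> k)\<^sup>2)) \<longrightarrow>
              0 \<le> r \<and>
              r \<le> ereal (sqrt (1 - lmin * (1 / a - lmax) / g\<^sup>2)) \<and>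
              sqrt (1 - lmin * (1 / a - lmax) / g\<^sup>2)
                < 1 / sqrt (1 + lmin * (1 / a - lmax) / g\<^sup>2) \<and>
              1 / sqrt (1 + lmin * (1 / a - lmax) / g\<^sup>2) < 1) \<and>
           (\<exists>(K::nat) (\<mu>::real). r < ereal \<mu> \<and> \<mu> < 1 \<and>
              (\<forall>k\<ge>K. infdist (x (Suc k)) C \<le> \<mu> * infdist (x k) C)) \<and>
           (\<exists>xhat\<in>C.
              (\<exists>(K::nat) (\<mu>::real). r < ereal \<mu> \<and> \<mu> < 1 \<and>
                 (\<forall>k\<ge>K. norm (x k - xhat) \<le> 2 * \<mu> ^ (k - K) * infdist (x K) C)) \<and>
              converges_R_linearly x xhat \<and>
              (affine C \<longrightarrow> xhat = proj C (x 0)))))"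
proof (intro conjI allI impI)
  have step: "norm (x (Suc k) - c) \<le> norm (x k - c)" if "c \<in> C" for c k
  proof -
    have "T k c = c" using that by (auto simp: C Fixpts_def)
    then have "(norm (x (Suc k) - c))\<^sup>2
        \<le> (norm (x k - c))\<^sup>2 - lam k * (1 - lam k * \<alpha> k) / \<alpha> k * (norm (x k - T k (x k)))\<^sup>2"
      unfolding iter using alpha[of k] lambda[of k]
      by (intro averaged_relaxed_step averaged) auto
    moreover have "0 \<le> lam k * (1 - lam k * \<alpha> k) / \<alpha> k * (norm (x k - T k (x k)))\<^sup>2"
      using alpha[of k] lambda[of k]
      by (intro mult_nonneg_nonneg divide_nonneg_nonneg) (auto simp: field_simps)
    ultimately have "(norm (x (Suc k) - c))\<^sup>2 \<le> (norm (x k - c))\<^sup>2" by linarith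
    then show ?thesis by (rule power2_le_imp_le) simp
  qed
  then show fejer: "fejer_monotone x C" by (simp add: fejer_monotone_def)
  have "C \<noteq> {}" using xbar by blast
  have "closed C"
    unfolding C using alpha
    by (intro closed_INT ballI closed_Fixpts averaged_imp_nonexpansive[OF averaged])
      (auto intro: less_imp_le)

  fix \<gamma> \<delta> \<rho> :: "nat \<Rightarrow> real"
  assume subreg: "\<forall>k. metrically_subregular_with (\<lambda>z. z - T k z) xbar 0 (\<gamma> k) (\<delta> k)"
    and "0 < (INF k. \<delta> k)"
    and start: "x 0 \<in> cball xbar (INF k. \<delta> k)"
    and rho: "\<forall>k. \<rho> k = sqrt (1 - lam k * (1 - lam k * \<alpha> k) / (\<alpha> k * (\<gamma> k)\<^sup>2))"
  have gamma_pos: "0 < \<gamma> k" for k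
    using subreg by (simp add: metrically_subregular_with_def)
  show ball: "x k \<in> cball xbar (INF k. \<delta> k)" for k
    using fejer_monotone_norm_antimono[OF fejer xbar, of 0 k] start
    by (simp add: dist_norm norm_minus_commute)
  have "bdd_below (range \<delta>)"
    using subreg by (intro bdd_belowI[of _ 0])
      (auto simp: metrically_subregular_with_def intro: less_imp_le)
  then have radius: "(INF k. \<delta> k) \<le> \<delta> k" for k by (intro cINF_lower) auto
  show contraction: "infdist (x (Suc k)) (Fixpts (T k)) \<le> \<rho> k * infdist (x k) (Fixpts (T k))" for k
  proof -
    have "x k \<in> cball xbar (\<delta> k)" using ball[of k] radius[of k] by simp
    moreover have "(\<lambda>z. z - T k z) -` {0} = Fixpts (T k)" by (auto simp: Fixpts_def)
    ultimately have "infdist (x k) (Fixpts (T k)) \<le> \<gamma> k * norm (x k - T k (x k))"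
      using subreg unfolding metrically_subregular_with_def by fastforce
    moreover have "Fixpts (T k) \<noteq> {}" using xbar C by blast
    ultimately show ?thesis
      unfolding iter using rho alpha[of k] lambda[of k] gamma_pos[of k]
      using averaged_relaxed_step_infdist[OF averaged, of k "lam k" "\<gamma> k" "x k"] by auto
  qed

  fix lmin lmax a g :: real and r :: ereal
  assume Fix: "\<forall>k. Fixpts (T k) = C"
    and lims: "liminf (\<lambda>k. ereal (lam k)) = ereal lmin" "limsup (\<lambda>k. ereal (lam k)) = ereal lmax"
      "limsup (\<lambda>k. ereal (\<alpha> k)) = ereal a" "limsup (\<lambda>k. ereal (\<gamma> k)) = ereal g"
    and "0 < a" "0 < lmin" "lmin \<le> lmax" "lmax < 1 / a"
    and r: "r = limsup (\<lambda>k. ereal (\<rho> k))"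
  interpret step_limits \<alpha> lam \<gamma> a lmin lmax g
    by unfold_locales (use alpha gamma_pos lims \<open>0 < a\<close> \<open>0 < lmin\<close> \<open>lmax < 1 / a\<close> in auto)
  have rho_factor: "\<rho> = factor" using rho by (simp add: fun_eq_iff factor_def)
  obtain K \<mu> where \<mu>: "r < ereal \<mu>" "0 < \<mu>" "\<mu> < 1" and le_\<mu>: "\<And>k. K \<le> k \<Longrightarrow> \<rho> k \<le> \<mu>"
    using ex_uniform_factor unfolding r rho_factor by metis
  have decrease: "infdist (x (Suc k)) C \<le> \<mu> * infdist (x k) C" if "K \<le> k" for k
    using contraction[of k] mult_right_mono[OF le_\<mu>[OF that] infdist_nonneg[of "x k" C]] Fix
    by simp
  then show "\<exists>K \<mu>. r < ereal \<mu> \<and> \<mu> < 1 \<and> (\<forall>k\<ge>K. infdist (x (Suc k)) C \<le> \<mu> * infdist (x k) C)"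
    using \<mu> by blast
  obtain xhat where xhat: "xhat \<in> C" "x \<longlonglongrightarrow> xhat"
    and rate: "\<And>k. K \<le> k \<Longrightarrow> norm (x k - xhat) \<le> 2 * \<mu> ^ (k - K) * infdist (x K) C"
    using fejer_monotone_linear_limit[where K = K, OF fejer \<open>C \<noteq> {}\<close> \<open>closed C\<close> less_imp_le[OF \<mu>(2)] \<mu>(3)]
      decrease by metis
  have "converges_R_linearly x xhat"
    by (rule converges_R_linearly_if_geometric_bound[OF \<mu>(2,3), of "2 * infdist (x K) C" K])
      (use rate in \<open>auto simp: infdist_nonneg mult_ac\<close>)
  moreover have "affine C \<longrightarrow> xhat = proj C (x 0)"
    using fejer_monotone_affine_limit[OF fejer _ xhat(2,1)] by blast
  ultimately show "\<exists>xhat\<in>C. (\<exists>K \<mu>. r < ereal \<mu> \<and> \<mu> < 1 \<and>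
        (\<forall>k\<ge>K. norm (x k - xhat) \<le> 2 * \<mu> ^ (k - K) * infdist (x K) C)) \<and>
      converges_R_linearly x xhat \<and> (affine C \<longrightarrow> xhat = proj C (x 0))"
    using xhat(1) \<mu> rate by blast

  assume radicand: "\<forall>k. 0 \<le> 1 - lam k * (1 - lam k * \<alpha> k) / (\<alpha> k * (\<gamma> k)\<^sup>2)"
  then have "0 < g" using g_pos_if_radicands_nonneg by blast
  define t where "t = lmin * (1 / a - lmax) / g\<^sup>2"
  have "0 < t" using \<open>0 < g\<close> \<open>0 < lmin\<close> \<open>lmax < 1 / a\<close> by (simp add: t_def)
  show "0 \<le> r"
    unfolding r using rho radicand by (intro le_Limsup) auto
  show "r \<le> ereal (sqrt (1 - lmin * (1 / a - lmax) / g\<^sup>2))"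
    using limsup_factor_le[OF \<open>0 < g\<close>] by (simp add: r rho_factor gain_0(2))
  show "sqrt (1 - lmin * (1 / a - lmax) / g\<^sup>2) < 1 / sqrt (1 + lmin * (1 / a - lmax) / g\<^sup>2)"
    "1 / sqrt (1 + lmin * (1 / a - lmax) / g\<^sup>2) < 1"
    using sqrt_one_minus_less_inverse_sqrt_one_plus[OF \<open>0 < t\<close>] unfolding t_def by auto
qed

end
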